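(* Let $(X,d)$ be a Hadamard space, let $C\subseteq X$ be a nonempty closed convex subset, and let $f:X\to(-\infty,\infty]$ be a proper convex lower semicontinuous function. Let $m\ge 1$ and let $T_1,\dots,T_m:C\to C$ be uniformly continuous total asymptotically quasi nonexpansive mappings, where $T_i$ has associated sequences $\{\lambda_{in}\}_{n\ge1}$, $\{\mu_{in}\}_{n\ge1}$ and associated function $\xi_i$, such that for each $i=1,\dots,m$: (C1) $\sum_{n=1}^\infty \lambda_{in}<\infty$ and $\sum_{n=1}^\infty\mu_{in}<\infty$; (C2) there exist constants $M_i,M_i^*>0$ such that $\xi_i(s)\le M_i^* s$ for all $s\ge M_i$. Let $\{\alpha_n\}$ be a sequence in $[0,1]$ with $0<a<\alpha_n\le b<1$ for all $n\ge1$, for some constants $a,b\in(0,1)$, and let $\{k_n\}$ be a sequence of positive real numbers. Let $x_1\in C$ and, for $n\ge 1$, define $$z_n=\operatorname*{arg\,min}_{y\in C}\Big[f(y)+\frac{1}{2k_n}d^2(y,x_n)\Big],\qquad y_{mn}=z_n,$$ $$y_{in}=(1-\alpha_n)\,y_{(i+1)n}\oplus\alpha_n\,T_{i+1}^n\,y_{(i+1)n}\quad (i=m-1,m-2,\dots,1),$$ $$x_{n+1}=(1-\alpha_n)\,y_{1n}\oplus\alpha_n\,T_1^n\,y_{1n}.$$ Assume that $$\mathbb F=\Big(\bigcap_{i=1}^mF(T_i)\Big)\cap\operatorname*{arg\,min}_{y\in C}f(y)\neq\emptyset .$$ Then the sequence $\{x_n\}$ converges strongly (i.e. in the metric $d$)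 to a point of $\mathbb F$ if and only if $\liminf_{n\to\infty}\operatorname{dist}(x_n,\mathbb F)=0$, where $\operatorname{dist}(x,\mathbb F)=\inf\{d(x,p):p\in\mathbb F\}$.
   Context: A Hadamard space is a complete $CAT(0)$ space. For $x,y$ in a $CAT(0)$ space and $t\in[0,1]$, $(1-t)x\oplus ty$ denotes the unique point $w$ on the geodesic segment $[x,y]$ with $d(x,w)=t\,d(x,y)$ and $d(y,w)=(1-t)d(x,y)$. A subset $C$ is convex if $[x,y]\subseteq C$ for all $x,y\in C$. A function $f$ is convex if $f\circ\theta$ is convex for every geodesic $\theta$. The function $f$ is assumed not to be identically $+\infty$ on $C$; then for $k>0$ and $x\in X$ the function $y\mapsto f(y)+\frac1{2k}d^2(y,x)$ has a unique minimizer over $C$, and $\arg\min$ in the definition of $z_n$ denotes this point. In the definition of $\mathbb F$, $\arg\min_{y\in C}f(y)$ is the set of all $x\in C$ with $f(x)=\min_{y\in C}f(y)$. $F(T)=\{x\in C:Tx=x\}$, and $T^n$ is the $n$-th iterate of $T$. A mapping $T:C\to C$ with $F(T)\ne\emptyset$ is total asymptotically quasi nonexpansive, with sequences $\{\lambda_n\},\{\mu_n\}$ and function $\xi$, if $\lambda_n,\mu_n\ge0$, $\lambda_n\to0$, $\mu_n\to0$, $\xi:[0,\infty)\to[0,\infty)$ is strictly increasing and continuous with $\xi(0)=0$, and $$d(T^nx,p)\le d(x,p)+\lambda_n\,\xi(d(x,p))+\mu_n\quad\text{for all }x\in C,\ p\in F(T),\ n\ge1.$$ *)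

theory Defs
  imports "HOL-Analysis.Analysis"
begin

section \<open>Geodesics and Hadamard spaces\<close>

text \<open>The metric space under consideration is the whole type \<open>'a\<close>.\<close>

definition geodesic :: "real \<Rightarrow> (real \<Rightarrow> 'a::metric_space) \<Rightarrow> bool" where
  "geodesic l \<theta> \<longleftrightarrow> 0 \<le> l \<and> (\<forall>s\<in>{0..l}. \<forall>t\<in>{0..l}. dist (\<theta> s) (\<theta> t) = \<bar>s - t\<bar>)"

definition is_geodesic_segment :: "'a::metric_space \<Rightarrow> 'a \<Rightarrow> 'a set \<Rightarrow> bool" where
  "is_geodesic_segment x y S \<longleftrightarrow>
     (\<exists>l \<theta>. geodesic l \<theta> \<and> \<theta> 0 = x \<and> \<theta> l = y \<and> S = \<theta> ` {0..l})"

text \<open>Relation between a point \<open>p\<close> of the geodesic triangle with vertices \<open>x, y, z\<close> and sides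
  \<open>Sxy, Syz, Sxz\<close> and its comparison point \<open>p'\<close> on the Euclidean triangle with vertices
  \<open>x', y', z'\<close>.\<close>

definition comparison_point ::
  "'a::metric_space \<Rightarrow> 'a \<Rightarrow> 'a \<Rightarrow> 'a set \<Rightarrow> 'a set \<Rightarrow> 'a set \<Rightarrow>
   real^2 \<Rightarrow> real^2 \<Rightarrow> real^2 \<Rightarrow> 'a \<Rightarrow> real^2 \<Rightarrow> bool" where
  "comparison_point x y z Sxy Syz Sxz x' y' z' p p' \<longleftrightarrow>
     (p \<in> Sxy \<and> p' \<in> closed_segment x' y' \<and> dist x' p' = dist x p) \<or>
     (p \<in> Syz \<and> p' \<in> closed_segment y' z' \<and> dist y' p' = dist y p) \<or>
     (p \<in> Sxz \<and> p' \<in> closed_segment x' z' \<and> dist x' p' = dist x p)"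

definition CAT0_space :: "'a::metric_space itself \<Rightarrow> bool" where
  "CAT0_space _ \<longleftrightarrow>
     (\<forall>x y :: 'a. \<exists>S. is_geodesic_segment x y S) \<and>
     (\<forall>(x::'a) y z Sxy Syz Sxz (x' :: real^2) y' z'.
        is_geodesic_segment x y Sxy \<and> is_geodesic_segment y z Syz \<and> is_geodesic_segment x z Sxz \<and>
        dist x' y' = dist x y \<and> dist y' z' = dist y z \<and> dist x' z' = dist x z \<longrightarrow>
        (\<forall>p p' q q'.
           comparison_point x y z Sxy Syz Sxz x' y' z' p p' \<and>
           comparison_point x y z Sxy Syz Sxz x' y' z' q q' \<longrightarrow>
           dist p q \<le> dist p' q'))"

definition Hadamard_space :: "'a::metric_space itself \<Rightarrow> bool" where
  "Hadamard_space _ \<longleftrightarrow> CAT0_space TYPE('a) \<and> complete (UNIV :: 'a set)"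

text \<open>The descriptions below are meant for CAT(0) spaces, where they denote; see the
  uniqueness lemmas.\<close>

definition geodesic_segment :: "'a::metric_space \<Rightarrow> 'a \<Rightarrow> 'a set" where
  "geodesic_segment x y = (THE S. is_geodesic_segment x y S)"

text \<open>\<open>geodesic_comb t x y\<close> is the point \<open>(1 - t) x \<oplus> t y\<close>.\<close>

definition geodesic_comb :: "real \<Rightarrow> 'a::metric_space \<Rightarrow> 'a \<Rightarrow> 'a" where
  "geodesic_comb t x y =
     (THE w. w \<in> geodesic_segment x y \<and> dist x w = t * dist x y \<and> dist y w = (1 - t) * dist x y)"

lemma CAT0_ex1_geodesic_segment:
  fixes x y :: "'a::metric_space"
  assumes "CAT0_space TYPE('a)"
  shows "\<exists>!S. is_geodesic_segment x y S"
proof -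
  have sub: "S \<subseteq> S'" if S: "is_geodesic_segment x y S" and S': "is_geodesic_segment x y S'"
    for S S' :: "'a set"
  proof
    fix p assume "p \<in> S"
    obtain l \<theta> where g: "geodesic l \<theta>" "\<theta> 0 = x" "\<theta> l = y" "S = \<theta> ` {0..l}"
      using S unfolding is_geodesic_segment_def by blast
    obtain l' \<theta>' where g': "geodesic l' \<theta>'" "\<theta>' 0 = x" "\<theta>' l' = y" "S' = \<theta>' ` {0..l'}"
      using S' unfolding is_geodesic_segment_def by blast
    have l: "l = dist x y" "l' = dist x y"
      using g(1-3) g'(1-3) unfolding geodesic_def by force+
    from \<open>p \<in> S\<close> g(4) obtain s where s: "s \<in> {0..l}" "p = \<theta> s" by blast
    define q where "q = \<theta>' s"
    have q: "q \<in> S'" using s l g'(4) by (auto simp: q_def)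
    have dp: "dist x p = s" "dist x q = s"
      using g(1,2) g'(1,2) s l unfolding geodesic_def q_def by force+
    define x' y' p' where "x' = (0::real^2)" and "y' = l *\<^sub>R (axis 1 1 :: real^2)"
      and "p' = s *\<^sub>R (axis 1 1 :: real^2)"
    have dd: "dist x' y' = dist x y" "dist x' p' = s"
      using s l by (auto simp: x'_def y'_def p'_def dist_norm norm_axis_1)
    have seg: "p' \<in> closed_segment x' y'"
    proof (cases "l = 0")
      case True
      then show ?thesis using s by (simp add: x'_def y'_def p'_def)
    next
      case False
      then show ?thesis unfolding in_segment x'_def y'_def p'_def
        using s by (intro exI[of _ "s / l"]) (auto simp: divide_simps)
    qed
    have "is_geodesic_segment y y {y}"
      unfolding is_geodesic_segment_def geodesic_def
      by (intro exI[of _ 0] exI[of _ "\<lambda>_. y"]) auto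
    moreover have "comparison_point x y y S {y} S' x' y' y' p p'"
      "comparison_point x y y S {y} S' x' y' y' q p'"
      using seg dd dp q \<open>p \<in> S\<close> by (simp_all add: comparison_point_def)
    ultimately have "dist p q \<le> dist p' p'"
      using assms S S' dd(1) unfolding CAT0_space_def by (metis dist_self)
    then show "p \<in> S'" using q by simp
  qed
  show ?thesis
    using assms sub unfolding CAT0_space_def by (metis subset_antisym)
qed

lemma CAT0_ex1_geodesic_comb:
  fixes x y :: "'a::metric_space"
  assumes "CAT0_space TYPE('a)" and t: "t \<in> {0..1}"
  shows "\<exists>!w. w \<in> geodesic_segment x y \<and> dist x w = t * dist x y \<and> dist y w = (1 - t) * dist x y"
proof -
  have "is_geodesic_segment x y (geodesic_segment x y)"
    unfolding geodesic_segment_def by (rule theI'[OF CAT0_ex1_geodesic_segment[OF assms(1)]])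
  then obtain l \<theta> where g: "geodesic l \<theta>" "\<theta> 0 = x" "\<theta> l = y" "geodesic_segment x y = \<theta> ` {0..l}"
    unfolding is_geodesic_segment_def by blast
  have l: "l = dist x y" using g(1-3) unfolding geodesic_def by force
  have tl: "t * l \<in> {0..l}" using t l by (auto simp: mult_left_le_one_le)
  have dx: "dist x (\<theta> s) = s" and dy: "dist y (\<theta> s) = l - s" if "s \<in> {0..l}" for s
    using that g(1-3) unfolding geodesic_def by force+
  show ?thesis
  proof (rule ex1I[of _ "\<theta> (t * l)"])
    show "\<theta> (t * l) \<in> geodesic_segment x y \<and> dist x (\<theta> (t * l)) = t * dist x y \<and>
        dist y (\<theta> (t * l)) = (1 - t) * dist x y"
      using tl g(4) dx[OF tl] dy[OF tl] l by (auto simp: algebra_simps)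
  next
    fix w assume w: "w \<in> geodesic_segment x y \<and> dist x w = t * dist x y \<and>
      dist y w = (1 - t) * dist x y"
    then obtain s where "s \<in> {0..l}" "w = \<theta> s" using g(4) by auto
    then show "w = \<theta> (t * l)" using dx w l by metis
  qed
qed

definition geodesically_convex :: "'a::metric_space set \<Rightarrow> bool" where
  "geodesically_convex C \<longleftrightarrow> (\<forall>x\<in>C. \<forall>y\<in>C. geodesic_segment x y \<subseteq> C)"

section \<open>Functions with values in the half-open extended line\<close>

text \<open>Functions into \<open>(-\<infinity>, \<infinity>]\<close> are rendered as \<open>ereal\<close>-valued functions avoiding \<open>-\<infinity>\<close>;
  on these no sum of the form \<open>\<infinity> - \<infinity>\<close> occurs in the convexity inequality, and \<open>0 * \<infinity> = 0\<close>.\<close>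

definition proper_fun :: "('a \<Rightarrow> ereal) \<Rightarrow> bool" where
  "proper_fun f \<longleftrightarrow> (\<forall>x. f x \<noteq> -\<infinity>) \<and> (\<exists>x. f x \<noteq> \<infinity>)"

definition geodesically_convex_fun :: "('a::metric_space \<Rightarrow> ereal) \<Rightarrow> bool" where
  "geodesically_convex_fun f \<longleftrightarrow>
     (\<forall>l \<theta>. geodesic l \<theta> \<longrightarrow>
        (\<forall>s\<in>{0..l}. \<forall>t\<in>{0..l}. \<forall>u\<in>{0..1}.
           f (\<theta> ((1 - u) * s + u * t)) \<le> ereal (1 - u) * f (\<theta> s) + ereal u * f (\<theta> t)))"

definition lower_semicontinuous :: "('a::topological_space \<Rightarrow> ereal) \<Rightarrow> bool" where
  "lower_semicontinuous f \<longleftrightarrow> (\<forall>x. f x \<le> Liminf (at x) f)"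

definition argmin_set :: "('a \<Rightarrow> ereal) \<Rightarrow> 'a set \<Rightarrow> 'a set" where
  "argmin_set f C = {x. is_arg_min f (\<lambda>y. y \<in> C) x}"

section \<open>Total asymptotically quasi nonexpansive mappings\<close>

definition fixed_points :: "'a set \<Rightarrow> ('a \<Rightarrow> 'a) \<Rightarrow> 'a set" where
  "fixed_points C T = {x \<in> C. T x = x}"

text \<open>The sequences are indexed by \<open>n \<ge> 1\<close>; their values at \<open>0\<close>, the values of \<open>T\<close> outside \<open>C\<close>
  and the values of \<open>\<xi>\<close> at negative reals are irrelevant.\<close>

definition total_asymp_quasi_nonexpansive ::
  "'a::metric_space set \<Rightarrow> ('a \<Rightarrow> 'a) \<Rightarrow> (nat \<Rightarrow> real) \<Rightarrow> (nat \<Rightarrow> real) \<Rightarrow> (real \<Rightarrow> real) \<Rightarrow> bool" where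
  "total_asymp_quasi_nonexpansive C T lam mu \<xi> \<longleftrightarrow>
     T \<in> C \<rightarrow> C \<and> fixed_points C T \<noteq> {} \<and>
     (\<forall>n\<ge>1. 0 \<le> lam n \<and> 0 \<le> mu n) \<and> lam \<longlonglongrightarrow> 0 \<and> mu \<longlonglongrightarrow> 0 \<and>
     \<xi> \<in> {0..} \<rightarrow> {0..} \<and> strict_mono_on {0..} \<xi> \<and> continuous_on {0..} \<xi> \<and> \<xi> 0 = 0 \<and>
     (\<forall>x\<in>C. \<forall>p\<in>fixed_points C T. \<forall>n\<ge>1.
        dist ((T ^^ n) x) p \<le> dist x p + lam n * \<xi> (dist x p) + mu n)"

end

theory Submission
  imports Defs
begin

text \<open>
  In a CAT(0) space, \<open>d\<^sup>2(\<cdot>, p)\<close> is uniformly convex along geodesics. Hence the proximal functional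
  has a minimizer \<open>z\<close> (minimizing sequences are Cauchy), and comparing \<open>z\<close> with points of the
  geodesic from \<open>z\<close> to a minimizer \<open>p\<close> of \<open>f\<close> gives \<open>d(z, p) \<le> d(x, p)\<close>. By (C2) each map satisfies
  \<open>d(T\<^sup>n u, p) \<le> (1 + c\<^sub>n) d(u, p) + e\<^sub>n\<close> with \<open>c\<close> and \<open>e\<close> summable and independent of \<open>p\<close>, and this
  survives the geodesic averaging, so that
  \<open>d(x\<^bsub>n+1\<^esub>, p) \<le> exp(c\<^sub>n) (d(x\<^sub>n, p) + e\<^sub>n)\<close> for every \<open>p\<close> in \<open>F\<close>. Iterating from an index \<open>n\<close> where
  \<open>dist(x\<^sub>n, F)\<close> and the tails of the series are small, all later iterates stay close to one
  point of \<open>F\<close>, so the sequence is Cauchy; its limit lies in \<open>F\<close> because \<open>F\<close> is closed.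
\<close>

section \<open>Geometry of CAT(0) spaces\<close>

lemma geodesic_comb_props:
  fixes x y :: "'a::metric_space"
  assumes "CAT0_space TYPE('a)" and "t \<in> {0..1}"
  shows "geodesic_comb t x y \<in> geodesic_segment x y"
    and "dist x (geodesic_comb t x y) = t * dist x y"
    and "dist y (geodesic_comb t x y) = (1 - t) * dist x y"
  using theI'[OF CAT0_ex1_geodesic_comb[OF assms, of x y]]
  unfolding geodesic_comb_def by blast+

lemma is_geodesic_segment_geodesic_segment:
  fixes x y :: "'a::metric_space"
  assumes "CAT0_space TYPE('a)"
  shows "is_geodesic_segment x y (geodesic_segment x y)"
  unfolding geodesic_segment_def by (rule theI'[OF CAT0_ex1_geodesic_segment[OF assms]])

lemma geodesic_comb_in_convex:
  fixes x y :: "'a::metric_space"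
  assumes "CAT0_space TYPE('a)" and "t \<in> {0..1}" and "geodesically_convex C" and "x \<in> C" and "y \<in> C"
  shows "geodesic_comb t x y \<in> C"
  using geodesic_comb_props(1)[OF assms(1,2), of x y] assms(3-5)
  unfolding geodesically_convex_def by blast

lemma geodesically_convex_fun_comb:
  fixes x y :: "'a::metric_space"
  assumes "CAT0_space TYPE('a)" and t: "t \<in> {0..1}" and f: "geodesically_convex_fun f"
  shows "f (geodesic_comb t x y) \<le> ereal (1 - t) * f x + ereal t * f y"
proof -
  obtain l \<theta> where g: "geodesic l \<theta>" "\<theta> 0 = x" "\<theta> l = y" "geodesic_segment x y = \<theta> ` {0..l}"
    using is_geodesic_segment_geodesic_segment[OF assms(1), of x y]
    unfolding is_geodesic_segment_def by blast
  have l: "l = dist x y" "0 \<le> l" using g(1-3) unfolding geodesic_def by force+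
  obtain s where s: "s \<in> {0..l}" "geodesic_comb t x y = \<theta> s"
    using geodesic_comb_props(1)[OF assms(1) t, of x y] g(4) by auto
  have "dist x (\<theta> s) = s" using s(1) g(1,2) l unfolding geodesic_def by force
  then have "s = t * l"
    using geodesic_comb_props(2)[OF assms(1) t, of x y] s(2) l(1) by simp
  moreover have "f (\<theta> ((1 - t) * 0 + t * l)) \<le> ereal (1 - t) * f (\<theta> 0) + ereal t * f (\<theta> l)"
    using f g(1) t l(2) unfolding geodesically_convex_fun_def by (metis atLeastAtMost_iff order_refl)
  ultimately show ?thesis using s(2) g(2,3) by simp
qed

section \<open>Euclidean comparison triangles and the distance inequalities they give\<close>

lemma dist_vec2: "dist (x::real^2) y = sqrt ((x$1 - y$1)\<^sup>2 + (x$2 - y$2)\<^sup>2)"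
  by (simp add: dist_vec_def L2_set_def sum_2 dist_real_def)

text \<open>With \<open>x'\<close> at the origin and \<open>y'\<close> on the first axis, the third
  vertex \<open>(u, v)\<close> has to solve two circle equations; the triangle inequality for
  \<open>A\<close>, \<open>B\<close>, \<open>D\<close> makes them solvable.\<close>

lemma comparison_triangle:
  fixes x y z :: "'a::metric_space"
  obtains x' y' z' :: "real^2"
  where "dist x' y' = dist x y" and "dist y' z' = dist y z" and "dist x' z' = dist x z"
proof -
  define A B D where "A = dist x y" and "B = dist y z" and "D = dist x z"
  have tri: "A \<le> B + D" "B \<le> A + D" "D \<le> A + B" and nn: "0 \<le> A" "0 \<le> B" "0 \<le> D"
    unfolding A_def B_def D_def by (metis dist_commute dist_triangle add.commute zero_le_dist)+
  obtain u v :: real where uv: "u\<^sup>2 + v\<^sup>2 = D\<^sup>2" "(A - u)\<^sup>2 + v\<^sup>2 = B\<^sup>2"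
  proof (cases "A = 0")
    case True
    then have "B = D" using tri by linarith
    then show ?thesis using that[of D 0] True by simp
  next
    case False
    \<comment> \<open>Subtracting the circle equations forces this \<open>u\<close> (law of
      cosines). The bounds \<open>- D \<le> u \<le> D\<close> shown next allow \<open>v\<close> to
      be a real square root.\<close>
    define u where "u = (D\<^sup>2 + A\<^sup>2 - B\<^sup>2) / (2 * A)"
    have 2: "2 * A * u = D\<^sup>2 + A\<^sup>2 - B\<^sup>2" using False by (simp add: u_def)
    have "(D - A)\<^sup>2 \<le> B\<^sup>2" using tri by (intro abs_le_square_iff[THEN iffD1]) linarith
    then have "2 * A * u \<le> 2 * A * D" unfolding 2 by (simp add: power2_eq_square algebra_simps)
    then have ub: "u \<le> D" using False nn by simp
    have "B\<^sup>2 \<le> (D + A)\<^sup>2" using tri nn by (intro power_mono) linarith+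
    then have "2 * A * (- D) \<le> 2 * A * u" unfolding 2 by (simp add: power2_eq_square algebra_simps)
    then have lb: "- D \<le> u" by (rule mult_left_le_imp_le) (use False nn in simp)
    have "u\<^sup>2 \<le> D\<^sup>2" using ub lb by (intro abs_le_square_iff[THEN iffD1]) linarith
    then have v: "(sqrt (D\<^sup>2 - u\<^sup>2))\<^sup>2 = D\<^sup>2 - u\<^sup>2" by simp
    show ?thesis
      by (rule that[of u "sqrt (D\<^sup>2 - u\<^sup>2)"], unfold v)
        (use 2 in \<open>simp_all add: power2_eq_square algebra_simps\<close>)
  qed
  define x' y' z' :: "real^2" where "x' = 0" and "y' = vector [A, 0]" and "z' = vector [u, v]"
  show ?thesis
  proof (rule that[of x' y' z'])
    show "dist x' y' = dist x y"
      using nn unfolding dist_vec2 x'_def y'_def by (simp add: A_def)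
    show "dist y' z' = dist y z"
      using nn unfolding dist_vec2 y'_def z'_def by (simp add: uv(2) B_def)
    show "dist x' z' = dist x z"
      using nn unfolding dist_vec2 x'_def z'_def by (simp add: uv(1) D_def)
  qed
qed

text \<open>Transfers the CAT(0) inequality to a point of one side and the opposite vertex: the
  comparison point of the geodesic combination is the affine combination, and \<open>z\<close>, as
  an endpoint of the side \<open>yz\<close>, has comparison point \<open>z'\<close>. Estimates in
  the plane then bound distances in the space.\<close>

lemma CAT0_comb_comparison:
  fixes x y z :: "'a::metric_space"
  assumes "CAT0_space TYPE('a)" and t: "t \<in> {0..1}"
  obtains x' y' z' :: "real^2"
  where "dist x' y' = dist x y" and "dist y' z' = dist y z" and "dist x' z' = dist x z"
    and "dist (geodesic_comb t x y) z \<le> dist ((1 - t) *\<^sub>R x' + t *\<^sub>R y') z'"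
proof -
  obtain x' y' z' :: "real^2"
    where d: "dist x' y' = dist x y" "dist y' z' = dist y z" "dist x' z' = dist x z"
    by (rule comparison_triangle)
  let ?w = "geodesic_comb t x y" and ?w' = "(1 - t) *\<^sub>R x' + t *\<^sub>R y'"
  let ?Sxy = "geodesic_segment x y" and ?Syz = "geodesic_segment y z"
    and ?Sxz = "geodesic_segment x z"
  note seg = is_geodesic_segment_geodesic_segment[OF assms(1)]
  have "?w' \<in> closed_segment x' y'" using t unfolding in_segment by auto
  moreover have "dist x' ?w' = dist x ?w"
  proof -
    have "x' - ?w' = t *\<^sub>R (x' - y')" by (simp add: algebra_simps)
    then have "dist x' ?w' = t * dist x' y'" using t by (simp add: dist_norm)
    then show ?thesis using d(1) geodesic_comb_props(2)[OF assms, of x y] by simp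
  qed
  ultimately have "comparison_point x y z ?Sxy ?Syz ?Sxz x' y' z' ?w ?w'"
    using geodesic_comb_props(1)[OF assms, of x y] by (simp add: comparison_point_def)
  moreover have "comparison_point x y z ?Sxy ?Syz ?Sxz x' y' z' z z'"
  proof -
    have "z \<in> ?Syz"
      using seg[of y z] unfolding is_geodesic_segment_def geodesic_def by force
    then show ?thesis using d(2) by (simp add: comparison_point_def)
  qed
  ultimately have "dist ?w z \<le> dist ?w' z'"
    using assms(1) seg d unfolding CAT0_space_def by blast
  with d that show ?thesis by blast
qed

lemma dist_geodesic_comb_le:
  fixes x y z :: "'a::metric_space"
  assumes "CAT0_space TYPE('a)" and t: "t \<in> {0..1}"
  shows "dist (geodesic_comb t x y) z \<le> (1 - t) * dist x z + t * dist y z"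
proof -
  obtain x' y' z' :: "real^2"
    where d: "dist x' y' = dist x y" "dist y' z' = dist y z" "dist x' z' = dist x z"
      "dist (geodesic_comb t x y) z \<le> dist ((1 - t) *\<^sub>R x' + t *\<^sub>R y') z'"
    by (rule CAT0_comb_comparison[OF assms])
  have "(1 - t) *\<^sub>R x' + t *\<^sub>R y' - z' = (1 - t) *\<^sub>R (x' - z') + t *\<^sub>R (y' - z')"
    by (simp add: algebra_simps)
  then have "dist ((1 - t) *\<^sub>R x' + t *\<^sub>R y') z' \<le> (1 - t) * dist x' z' + t * dist y' z'"
    using t norm_triangle_ineq[of "(1 - t) *\<^sub>R (x' - z')" "t *\<^sub>R (y' - z')"]
    by (simp add: dist_norm)
  then show ?thesis using d by simp
qed

text \<open>The Bruhat-Tits (CN) inequality for arbitrary \<open>t\<close>; in the plane it is an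
  inner product identity. Its negative term is the uniform convexity on which both proximal lemmas
  rest.\<close>

lemma dist_geodesic_comb_sq_le:
  fixes x y z :: "'a::metric_space"
  assumes "CAT0_space TYPE('a)" and t: "t \<in> {0..1}"
  shows "(dist (geodesic_comb t x y) z)\<^sup>2
    \<le> (1 - t) * (dist x z)\<^sup>2 + t * (dist y z)\<^sup>2 - t * (1 - t) * (dist x y)\<^sup>2"
proof -
  obtain x' y' z' :: "real^2"
    where d: "dist x' y' = dist x y" "dist y' z' = dist y z" "dist x' z' = dist x z"
      "dist (geodesic_comb t x y) z \<le> dist ((1 - t) *\<^sub>R x' + t *\<^sub>R y') z'"
    by (rule CAT0_comb_comparison[OF assms])
  define u v where "u = x' - z'" and "v = y' - z'"
  have "(1 - t) *\<^sub>R x' + t *\<^sub>R y' - z' = (1 - t) *\<^sub>R u + t *\<^sub>R v" "x' - y' = u - v"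
    by (simp_all add: u_def v_def algebra_simps)
  moreover have "(norm ((1 - t) *\<^sub>R u + t *\<^sub>R v))\<^sup>2
      = (1 - t) * (norm u)\<^sup>2 + t * (norm v)\<^sup>2 - t * (1 - t) * (norm (u - v))\<^sup>2"
    unfolding power2_norm_eq_inner
    by (simp add: inner_add_left inner_add_right inner_diff_left inner_diff_right
        inner_commute[of v u] algebra_simps)
  ultimately have "(dist ((1 - t) *\<^sub>R x' + t *\<^sub>R y') z')\<^sup>2
      = (1 - t) * (dist x' z')\<^sup>2 + t * (dist y' z')\<^sup>2 - t * (1 - t) * (dist x' y')\<^sup>2"
    by (simp add: dist_norm u_def v_def)
  then show ?thesis using power_mono[OF d(4) zero_le_dist, of 2] d(1-3) by simp
qed

section \<open>Minimizers and the proximal map\<close>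

text \<open>\<open>Liminf\<close> at \<open>x\<close> leaves out \<open>x\<close> itself; at a limit
  point each punctured ball still meets the sublevel set, so every infimum involved is at most
  \<open>c\<close>.\<close>

lemma closed_sublevel_lower_semicontinuous:
  fixes f :: "'a::metric_space \<Rightarrow> ereal"
  assumes "lower_semicontinuous f"
  shows "closed {x. f x \<le> c}"
  unfolding closed_limpt
proof (intro allI impI)
  fix x assume lim: "x islimpt {x. f x \<le> c}"
  have "f x \<le> Liminf (at x) f" using assms unfolding lower_semicontinuous_def by blast
  also have "\<dots> \<le> c"
    unfolding Liminf_at
  proof (rule SUP_least)
    fix e :: real assume "e \<in> {0<..}"
    then obtain y where "f y \<le> c" "y \<noteq> x" "dist y x < e"
      using lim unfolding islimpt_approachable by auto
    then show "Inf (f ` (ball x e - {x})) \<le> c"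
      by (intro INF_lower2[of y]) (auto simp: dist_commute)
  qed
  finally show "x \<in> {x. f x \<le> c}" by simp
qed

text \<open>A minimizer is a point of \<open>C\<close> lying in the sublevel set at each height
  \<open>f u\<close> with \<open>u\<close> in \<open>C\<close>.\<close>

lemma closed_argmin_set:
  fixes f :: "'a::metric_space \<Rightarrow> ereal"
  assumes "closed C" and "lower_semicontinuous f"
  shows "closed (argmin_set f C)"
proof -
  have "argmin_set f C = C \<inter> (\<Inter>u\<in>C. {x. f x \<le> f u})"
    by (auto simp: argmin_set_def is_arg_min_linorder)
  then show ?thesis
    using assms by (auto intro!: closed_Int closed_INT closed_sublevel_lower_semicontinuous)
qed

lemma closed_fixed_points:
  fixes T :: "'a::metric_space \<Rightarrow> 'a"
  assumes "closed C" and "continuous_on C T"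
  shows "closed (fixed_points C T)"
proof -
  have "fixed_points C T = {x \<in> C. dist (T x) x = 0}"
    by (simp add: fixed_points_def)
  also have "closed \<dots>"
    by (rule continuous_closed_preimage_constant[OF _ assms(1)])
      (intro continuous_intros assms(2))
  finally show ?thesis .
qed

text \<open>Direct method: \<open>c\<close> keeps the infimum finite, the midpoint inequality makes
  a minimizing sequence Cauchy, completeness supplies a limit, and lower semicontinuity shows that
  it is optimal. Here \<open>r\<close> stands for \<open>1 / (2 * k n)\<close>.\<close>

lemma proximal_minimizer_exists:
  fixes f :: "'a::metric_space \<Rightarrow> ereal"
  assumes H: "Hadamard_space TYPE('a)"
    and C: "closed C" "geodesically_convex C"
    and f: "geodesically_convex_fun f" "lower_semicontinuous f"
    and bound: "\<And>u. u \<in> C \<Longrightarrow> ereal c \<le> f u"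
    and fin: "p \<in> C" "f p \<noteq> \<infinity>"
    and r: "0 < r"
  shows "\<exists>u. is_arg_min (\<lambda>u. f u + ereal (r * (dist u x)\<^sup>2)) (\<lambda>u. u \<in> C) u"
proof -
  have cat: "CAT0_space TYPE('a)" and compl: "complete (UNIV :: 'a set)"
    using H unfolding Hadamard_space_def by auto
  define g where "g u = f u + ereal (r * (dist u x)\<^sup>2)" for u
  define J where "J = (INF u\<in>C. g u)"
  have gb: "ereal c \<le> g u" if "u \<in> C" for u
    using add_mono[OF bound[OF that], of "ereal 0" "ereal (r * (dist u x)\<^sup>2)"] r
    by (simp add: g_def)
  have "ereal c \<le> J" unfolding J_def using gb by (rule INF_greatest)
  moreover have "J \<le> g p" unfolding J_def using fin(1) by (rule INF_lower)
  moreover have "g p \<noteq> \<infinity>" using fin(2) by (simp add: g_def)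
  ultimately obtain I where I: "J = ereal I" by (cases J) auto
  have low: "ereal I \<le> g u" if "u \<in> C" for u
    using INF_lower[OF that, of g] I J_def by simp
  have fr: "\<exists>s. f u = ereal s \<and> I \<le> s + r * (dist u x)\<^sup>2 \<and> s + r * (dist u x)\<^sup>2 \<le> I + \<delta>"
    if "u \<in> C" "g u \<le> ereal (I + \<delta>)" for u \<delta>
    using that bound[OF that(1)] low[OF that(1)] by (cases "f u") (auto simp: g_def)
  \<comment> \<open>For the midpoint \<open>?w\<close> and \<open>d = dist u v\<close>, convexity of
    \<open>f\<close> and the CN inequality give
    \<open>I \<le> g ?w \<le> I + \<delta> - r * d^2 / 4\<close>.\<close>
  have close: "(dist u v)\<^sup>2 \<le> 4 * \<delta> / r"
    if u: "u \<in> C" "g u \<le> ereal (I + \<delta>)" and v: "v \<in> C" "g v \<le> ereal (I + \<delta>)" for u v \<delta>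
  proof -
    obtain s where s: "f u = ereal s" "s + r * (dist u x)\<^sup>2 \<le> I + \<delta>" using fr[OF u] by blast
    obtain s' where s': "f v = ereal s'" "s' + r * (dist v x)\<^sup>2 \<le> I + \<delta>" using fr[OF v] by blast
    let ?w = "geodesic_comb (1/2) u v"
    have h: "(1/2::real) \<in> {0..1}" by simp
    have "?w \<in> C" by (rule geodesic_comb_in_convex[OF cat h C(2) u(1) v(1)])
    moreover have fw: "f ?w \<le> ereal ((s + s') / 2)"
      using geodesically_convex_fun_comb[OF cat h f(1), of u v] s(1) s'(1)
      by (simp add: add_divide_distrib)
    ultimately obtain q where q: "f ?w = ereal q" "q \<le> (s + s') / 2"
      using bound[of ?w] by (cases "f ?w") auto
    have "I \<le> q + r * (dist ?w x)\<^sup>2"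
      using low[OF \<open>?w \<in> C\<close>] q(1) by (simp add: g_def)
    moreover have "r * (dist ?w x)\<^sup>2
        \<le> r * ((dist u x)\<^sup>2 / 2 + (dist v x)\<^sup>2 / 2 - (dist u v)\<^sup>2 / 4)"
      using dist_geodesic_comb_sq_le[OF cat h, of u v x] r by (intro mult_left_mono) auto
    ultimately have "r * (dist u v)\<^sup>2 \<le> 4 * \<delta>"
      using q(2) s(2) s'(2) by (simp add: algebra_simps)
    then show ?thesis using r by (simp add: field_simps)
  qed
  have "\<exists>u\<in>C. g u \<le> ereal (I + 1 / Suc n)" for n
  proof -
    have "(INF u\<in>C. g u) < ereal (I + 1 / Suc n)" using I J_def by simp
    then show ?thesis unfolding INF_less_iff by (blast intro: less_imp_le)
  qed
  then obtain s where s: "\<And>n. s n \<in> C" "\<And>n. g (s n) \<le> ereal (I + 1 / Suc n)" by metis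
  have tail: "g (s n) \<le> ereal (I + 1 / Suc N)" if "N \<le> n" for n N
  proof (rule order_trans[OF s(2)])
    show "ereal (I + 1 / Suc n) \<le> ereal (I + 1 / Suc N)"
      using that by (simp add: frac_le)
  qed
  have "Cauchy s"
    unfolding Cauchy_def
  proof (intro allI impI)
    fix e :: real assume e: "0 < e"
    have "0 < r * e\<^sup>2 / 4" using e r by simp
    then obtain N where N: "1 / Suc N < r * e\<^sup>2 / 4"
      using reals_Archimedean by (metis inverse_eq_divide)
    have "dist (s i) (s j) < e" if "N \<le> i" "N \<le> j" for i j
    proof -
      have "(dist (s i) (s j))\<^sup>2 \<le> 4 * (1 / Suc N) / r"
        using that by (intro close s tail)
      also have "\<dots> < e\<^sup>2" unfolding pos_divide_less_eq[OF r] using N by (simp add: mult.commute)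
      finally show ?thesis using e by (simp add: power_less_imp_less_base)
    qed
    then show "\<exists>M. \<forall>m\<ge>M. \<forall>n\<ge>M. dist (s m) (s n) < e" by blast
  qed
  then obtain u where u: "s \<longlonglongrightarrow> u" using compl unfolding complete_def by blast
  have uC: "u \<in> C" using closed_sequentially[OF C(1) s(1) u] .
  \<comment> \<open>Along the sequence,
    \<open>f (s n) \<le> I + 1 / Suc n - r * dist (s n) x ^ 2\<close>. The right side converges, so
    a tail of \<open>s\<close> lies in a sublevel set just above the limit value, and that set is
    closed.\<close>
  have "f u \<le> ereal (I - r * (dist u x)\<^sup>2) + ereal e" if e: "0 < e" for e
  proof -
    have "(\<lambda>n. I + 1 / Suc n - r * (dist (s n) x)\<^sup>2) \<longlonglongrightarrow> I + 0 - r * (dist u x)\<^sup>2"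
      by (intro tendsto_intros u LIMSEQ_Suc[OF lim_1_over_n])
    then have "\<forall>\<^sub>F n in sequentially.
        I + 1 / Suc n - r * (dist (s n) x)\<^sup>2 < I - r * (dist u x)\<^sup>2 + e"
      using e by (intro order_tendstoD(2)) auto
    then have "\<forall>\<^sub>F n in sequentially. s n \<in> {v. f v \<le> ereal (I - r * (dist u x)\<^sup>2 + e)}"
    proof eventually_elim
      case (elim n)
      then show ?case using fr[OF s(1) s(2), of n] by auto
    qed
    from Lim_in_closed_set[OF closed_sublevel_lower_semicontinuous[OF f(2)] this _ u]
    show ?thesis by simp
  qed
  then have "f u \<le> ereal (I - r * (dist u x)\<^sup>2)" by (rule ereal_le_epsilon2)
  then have "g u \<le> ereal I" by (cases "f u") (auto simp: g_def)
  then have "is_arg_min g (\<lambda>u. u \<in> C) u"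
    using uC low by (auto simp: is_arg_min_linorder intro: order_trans)
  then show ?thesis unfolding g_def by blast
qed

text \<open>Between \<open>z\<close> and \<open>p\<close> the values of \<open>f\<close> stay below
  \<open>f z\<close>, so optimality of \<open>z\<close> forbids the distance to \<open>x\<close> to
  shrink there; uniform convexity then gives the Pythagorean inequality
  \<open>d(z,x)^2 + d(z,p)^2 \<le> d(p,x)^2\<close>, which is stronger than the claim.\<close>

lemma proximal_minimizer_dist_le:
  fixes f :: "'a::metric_space \<Rightarrow> ereal"
  assumes cat: "CAT0_space TYPE('a)" and C: "geodesically_convex C"
    and f: "geodesically_convex_fun f" "\<And>u. f u \<noteq> -\<infinity>"
    and p: "p \<in> argmin_set f C" "f p \<noteq> \<infinity>" and r: "0 < r"
    and z: "is_arg_min (\<lambda>u. f u + ereal (r * (dist u x)\<^sup>2)) (\<lambda>u. u \<in> C) z"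
  shows "dist z p \<le> dist x p"
proof -
  have pC: "p \<in> C" and pmin: "\<And>u. u \<in> C \<Longrightarrow> f p \<le> f u"
    using p(1) by (auto simp: argmin_set_def is_arg_min_linorder)
  have zC: "z \<in> C"
    and zmin: "\<And>u. u \<in> C \<Longrightarrow> f z + ereal (r * (dist z x)\<^sup>2) \<le> f u + ereal (r * (dist u x)\<^sup>2)"
    using z by (auto simp: is_arg_min_linorder)
  obtain s' where s': "f p = ereal s'" using p(2) f(2)[of p] by (cases "f p") auto
  obtain s where s: "f z = ereal s" using zmin[OF pC] f(2)[of z] s' by (cases "f z") auto
  have ss: "s' \<le> s" using pmin[OF zC] s s' by simp
  \<comment> \<open>Compare \<open>z\<close> with the point at parameter \<open>t\<close>.
    Positivity of \<open>t\<close> lets the common factor cancel; the limit \<open>t\<close> to 0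
    afterwards removes the loss in \<open>1 - t\<close>.\<close>
  have *: "(dist z x)\<^sup>2 \<le> (dist p x)\<^sup>2 - (1 - t) * (dist z p)\<^sup>2" if t: "0 < t" "t \<le> 1" for t :: real
  proof -
    have t': "t \<in> {0..1}" using t by simp
    let ?w = "geodesic_comb t z p"
    have wC: "?w \<in> C" by (rule geodesic_comb_in_convex[OF cat t' C zC pC])
    have "f ?w \<le> ereal ((1 - t) * s + t * s')"
      using geodesically_convex_fun_comb[OF cat t' f(1), of z p] s s' by simp
    also have "\<dots> \<le> ereal s" using ss t mult_left_mono[OF ss, of t] by (simp add: algebra_simps)
    finally obtain q where q: "f ?w = ereal q" "q \<le> s" using f(2)[of ?w] by (cases "f ?w") auto
    have "s + r * (dist z x)\<^sup>2 \<le> q + r * (dist ?w x)\<^sup>2" using zmin[OF wC] s q by simp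
    then have "r * (dist z x)\<^sup>2 \<le> r * (dist ?w x)\<^sup>2" using q(2) by linarith
    then have "(dist z x)\<^sup>2 \<le> (dist ?w x)\<^sup>2" using r by (rule mult_left_le_imp_le)
    then have "(dist z x)\<^sup>2
        \<le> (1 - t) * (dist z x)\<^sup>2 + t * (dist p x)\<^sup>2 - t * (1 - t) * (dist z p)\<^sup>2"
      using dist_geodesic_comb_sq_le[OF cat t', of z p x] by (rule order_trans)
    then have "t * (dist z x)\<^sup>2 \<le> t * ((dist p x)\<^sup>2 - (1 - t) * (dist z p)\<^sup>2)"
      by (simp add: algebra_simps)
    then show ?thesis using t by simp
  qed
  have "((\<lambda>t. (dist p x)\<^sup>2 - (1 - t) * (dist z p)\<^sup>2) \<longlongrightarrow> (dist p x)\<^sup>2 - (1 - 0) * (dist z p)\<^sup>2)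
      (at_right 0)"
    by (intro tendsto_intros)
  moreover have "\<forall>\<^sub>F t in at_right (0::real). (dist z x)\<^sup>2 \<le> (dist p x)\<^sup>2 - (1 - t) * (dist z p)\<^sup>2"
    using eventually_at_right_real[OF zero_less_one] by eventually_elim (rule *, auto)
  ultimately have "(dist z x)\<^sup>2 \<le> (dist p x)\<^sup>2 - (1 - 0) * (dist z p)\<^sup>2"
    by (rule tendsto_lowerbound) simp
  then have "(dist z x)\<^sup>2 + (dist z p)\<^sup>2 \<le> (dist p x)\<^sup>2" by simp
  then have "(dist z p)\<^sup>2 \<le> (dist p x)\<^sup>2" using zero_le_power2[of "dist z x"] by linarith
  then have "dist z p \<le> dist p x" by (rule power2_le_imp_le) simp
  then show ?thesis by (simp add: dist_commute)
qed

section \<open>Growth estimates\<close>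

text \<open>The shape \<open>exp S * (d + E)\<close> survives a further affine estimate:
  \<open>1 + c \<le> exp c\<close> moves the factor into the exponent, and \<open>e\<close> goes
  inside the bracket because \<open>exp (c + S) \<ge> 1\<close>.\<close>

lemma exp_affine_step:
  fixes c S D d E e e' :: real
  assumes "0 \<le> c" "0 \<le> S" "0 \<le> e" "D \<le> exp S * (d + E)" "0 \<le> D" "D' \<le> (1 + c) * D + e"
  shows "D' \<le> exp (c + S) * (d + (e + E))"
proof -
  have "(1 + c) * D \<le> exp c * (exp S * (d + E))"
    using assms by (intro mult_mono exp_ge_add_one_self) auto
  moreover have "1 * e \<le> exp (c + S) * e"
    using assms by (intro mult_right_mono) auto
  ultimately show ?thesis using assms(6) by (simp add: exp_add algebra_simps)
qed

text \<open>A discrete Gronwall bound. The start \<open>n\<close> is left free so that the error sum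
  runs over a tail only, which summability makes small.\<close>

lemma exp_growth_iterate:
  fixes D c e :: "nat \<Rightarrow> real"
  assumes "\<And>n. D (Suc n) \<le> exp (c n) * (D n + e n)" and "\<And>n. 0 \<le> c n" and "\<And>n. 0 \<le> e n"
  shows "D (n + j) \<le> exp (sum c {n..<n+j}) * (D n + sum e {n..<n+j})"
proof (induction j)
  case 0
  then show ?case by simp
next
  case (Suc j)
  let ?S = "sum c {n..<n+j}" and ?E = "sum e {n..<n+j}"
  have "1 * e (n + j) \<le> exp ?S * e (n + j)"
    using assms(2,3) by (intro mult_right_mono) (auto intro: sum_nonneg)
  then have "D (n + j) + e (n + j) \<le> exp ?S * (D n + ?E + e (n + j))"
    using Suc by (simp add: algebra_simps)
  then have "exp (c (n + j)) * (D (n + j) + e (n + j))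
      \<le> exp (c (n + j)) * (exp ?S * (D n + ?E + e (n + j)))"
    by (intro mult_left_mono) auto
  then show ?case
    using assms(1)[of "n + j"] by (simp add: exp_add algebra_simps)
qed

text \<open>The coefficients in \<open>step\<close> do not depend on \<open>p\<close>, so the
  reference point can be chosen anew at a late index where the iterate is close to
  \<open>F\<close>.\<close>

lemma quasi_Fejer_convergent:
  fixes x :: "nat \<Rightarrow> 'a::metric_space"
  assumes compl: "complete (UNIV :: 'a set)" and F: "closed F" "F \<noteq> {}"
    and step: "\<And>n p. p \<in> F \<Longrightarrow> dist (x (Suc n)) p \<le> exp (c n) * (dist (x n) p + e n)"
    and c: "\<And>n. 0 \<le> c n" "summable c" and e: "\<And>n. 0 \<le> e n" "summable e"
    and freq: "\<And>\<epsilon> N. 0 < \<epsilon> \<Longrightarrow> \<exists>n\<ge>N. infdist (x n) F < \<epsilon>"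
  shows "\<exists>p\<in>F. x \<longlonglongrightarrow> p"
proof -
  have key: "\<exists>n. \<exists>p\<in>F. \<forall>i\<ge>n. dist (x i) p < \<epsilon>" if "0 < \<epsilon>" for \<epsilon>
  proof -
    \<comment> \<open>\<open>K\<close> dominates every factor \<open>exp (sum c ...)\<close>; with
      this \<open>\<delta>\<close>, the distance at index \<open>n\<close> and the error tail each
      contribute less than \<open>\<epsilon> / 2\<close>.\<close>
    define K where "K = exp (suminf c)"
    define \<delta> where "\<delta> = \<epsilon> / (2 * K)"
    have K: "0 < K" by (simp add: K_def)
    then have "0 < \<delta>" using that by (simp add: \<delta>_def)
    obtain N where N: "\<And>a b. N \<le> a \<Longrightarrow> norm (sum e {a..<b}) < \<delta>"
      using e(2) \<open>0 < \<delta>\<close> unfolding summable_Cauchy by blast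
    obtain n where n: "N \<le> n" "infdist (x n) F < \<delta>" using freq \<open>0 < \<delta>\<close> by blast
    then obtain p where p: "p \<in> F" "dist (x n) p < \<delta>"
      using F(2) by (auto simp: infdist_def cINF_less_iff)
    have "dist (x (n + j)) p < \<epsilon>" for j
    proof -
      have "dist (x (n + j)) p \<le> exp (sum c {n..<n+j}) * (dist (x n) p + sum e {n..<n+j})"
        by (rule exp_growth_iterate) (use step[OF p(1)] c e in auto)
      also have "\<dots> \<le> K * (dist (x n) p + sum e {n..<n+j})"
        unfolding K_def using c e
        by (intro mult_right_mono) (auto intro!: sum_le_suminf add_nonneg_nonneg sum_nonneg)
      also have "\<dots> < K * (\<delta> + \<delta>)"
        using p(2) N[OF n(1), of "n + j"] K by (intro mult_strict_left_mono add_strict_mono) auto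
      also have "\<dots> = \<epsilon>" using K by (simp add: \<delta>_def)
      finally show ?thesis .
    qed
    then show ?thesis using p(1) by (metis le_Suc_ex)
  qed
  have "Cauchy x"
    unfolding Cauchy_def
  proof (intro allI impI)
    fix \<epsilon> :: real assume "0 < \<epsilon>"
    then obtain n p where "\<And>i. n \<le> i \<Longrightarrow> dist (x i) p < \<epsilon> / 2" using key[of "\<epsilon> / 2"] by auto
    then show "\<exists>M. \<forall>m\<ge>M. \<forall>n\<ge>M. dist (x m) (x n) < \<epsilon>"
      by (metis dist_triangle_half_l dist_commute)
  qed
  then obtain q where q: "x \<longlonglongrightarrow> q" using compl unfolding complete_def by blast
  \<comment> \<open>Late iterates are close both to \<open>q\<close> and to a point of
    \<open>F\<close>, so \<open>q\<close> is in the closure of \<open>F\<close>.\<close>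
  have "\<exists>p\<in>F. dist p q < \<epsilon>" if "0 < \<epsilon>" for \<epsilon>
  proof -
    obtain n p where p: "p \<in> F" "\<And>i. n \<le> i \<Longrightarrow> dist (x i) p < \<epsilon> / 2"
      using key[of "\<epsilon> / 2"] \<open>0 < \<epsilon>\<close> by auto
    have "dist p q \<le> \<epsilon> / 2"
      by (rule Lim_dist_ubound[OF _ q])
        (use p(2) in \<open>auto intro!: eventually_sequentiallyI[of n] less_imp_le simp: dist_commute\<close>)
    then show ?thesis using p(1) \<open>0 < \<epsilon>\<close> by (intro bexI[of _ p]) auto
  qed
  then have "q \<in> F" using F(1) closed_approachable by blast
  then show ?thesis using q by blast
qed

text \<open>(C2) bounds \<open>\<xi>\<close> linearly only from \<open>M\<close> on; below
  \<open>M\<close> monotonicity gives \<open>\<xi> s < \<xi> M\<close>, so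
  \<open>\<xi> s \<le> M' * s + \<xi> M\<close> on the whole half-line. The resulting coefficients
  depend on neither \<open>u\<close> nor \<open>p\<close>. The shift to \<open>Suc n\<close> is
  there because the data start at index 1.\<close>

lemma total_asymp_quasi_nonexpansive_affine_bound:
  assumes T: "total_asymp_quasi_nonexpansive C T lam mu \<xi>"
    and sum: "summable (\<lambda>n. lam (Suc n))" "summable (\<lambda>n. mu (Suc n))"
    and growth: "\<exists>M>0. \<exists>M'>0. \<forall>s\<ge>M. \<xi> s \<le> M' * s"
  shows "\<exists>c e. (\<forall>n. 0 \<le> c n \<and> 0 \<le> e n) \<and> summable c \<and> summable e \<and>
    (\<forall>u\<in>C. \<forall>p\<in>fixed_points C T. \<forall>n.
       dist ((T ^^ Suc n) u) p \<le> (1 + c n) * dist u p + e n)"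
proof -
  obtain M M' where M: "0 < M" "0 < M'" "\<And>s. M \<le> s \<Longrightarrow> \<xi> s \<le> M' * s" using growth by blast
  have nn: "0 \<le> lam (Suc n)" "0 \<le> mu (Suc n)" for n
    using T unfolding total_asymp_quasi_nonexpansive_def by auto
  have xi0: "0 \<le> \<xi> M"
    using T M(1) unfolding total_asymp_quasi_nonexpansive_def by (auto simp: Pi_iff)
  have xi: "\<xi> s \<le> M' * s + \<xi> M" if "0 \<le> s" for s
  proof (cases "M \<le> s")
    case True
    then show ?thesis using M(3) xi0 by fastforce
  next
    case False
    then have "\<xi> s < \<xi> M"
      using T that unfolding total_asymp_quasi_nonexpansive_def by (auto simp: strict_mono_on_def)
    then show ?thesis using that M(2) by (simp add: add_increasing)
  qed
  have "dist ((T ^^ Suc n) u) p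
      \<le> (1 + lam (Suc n) * M') * dist u p + (lam (Suc n) * \<xi> M + mu (Suc n))"
    if "u \<in> C" "p \<in> fixed_points C T" for u p n
  proof -
    have "dist ((T ^^ Suc n) u) p \<le> dist u p + lam (Suc n) * \<xi> (dist u p) + mu (Suc n)"
      using T that unfolding total_asymp_quasi_nonexpansive_def by (auto simp del: funpow.simps)
    moreover have "lam (Suc n) * \<xi> (dist u p) \<le> lam (Suc n) * (M' * dist u p + \<xi> M)"
      using nn xi by (intro mult_left_mono) auto
    ultimately show ?thesis by (simp add: algebra_simps del: funpow.simps)
  qed
  then show ?thesis
    using nn M(2) xi0 sum
    by (intro exI[of _ "\<lambda>n. lam (Suc n) * M'"] exI[of _ "\<lambda>n. lam (Suc n) * \<xi> M + mu (Suc n)"])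
      (auto intro!: summable_add summable_mult2 simp del: funpow.simps)
qed

lemma liminf_zero_frequently_less:
  assumes "liminf (\<lambda>n. ereal (g n)) = 0" and "0 < \<epsilon>"
  shows "\<exists>n\<ge>N. g n < \<epsilon>"
proof (rule ccontr)
  assume "\<not> ?thesis"
  then have "\<forall>\<^sub>F n in sequentially. ereal \<epsilon> \<le> ereal (g n)"
    by (intro eventually_sequentiallyI[of N]) (auto simp: not_less)
  then have "ereal \<epsilon> \<le> liminf (\<lambda>n. ereal (g n))" by (rule Liminf_bounded)
  then show False using assms by simp
qed

section \<open>The convergence criterion for the proximal Mann-type iteration\<close>

theorem theorem3p4:
  fixes C :: "'a::metric_space set"
    and f :: "'a \<Rightarrow> ereal"
    and m :: nat
    and T :: "nat \<Rightarrow> 'a \<Rightarrow> 'a"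
    and lam mu :: "nat \<Rightarrow> nat \<Rightarrow> real"
    and \<xi> :: "nat \<Rightarrow> real \<Rightarrow> real"
    and \<alpha> k :: "nat \<Rightarrow> real"
    and a b :: real
    and x z :: "nat \<Rightarrow> 'a"
    and y :: "nat \<Rightarrow> nat \<Rightarrow> 'a"
    and F :: "'a set"
  assumes "Hadamard_space TYPE('a)"
    and "C \<noteq> {}" and "closed C" and "geodesically_convex C"
    and "proper_fun f" and "geodesically_convex_fun f" and "lower_semicontinuous f"
    and "\<exists>u\<in>C. f u \<noteq> \<infinity>"
    and "m \<ge> 1"
    and "\<And>i. i \<in> {1..m} \<Longrightarrow> uniformly_continuous_on C (T i)"
    and "\<And>i. i \<in> {1..m} \<Longrightarrow> total_asymp_quasi_nonexpansive C (T i) (lam i) (mu i) (\<xi> i)"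
    and C1: "\<And>i. i \<in> {1..m} \<Longrightarrow>
               summable (\<lambda>n. lam i (Suc n)) \<and> summable (\<lambda>n. mu i (Suc n))"
    and C2: "\<And>i. i \<in> {1..m} \<Longrightarrow> \<exists>M>0. \<exists>M'>0. \<forall>s\<ge>M. \<xi> i s \<le> M' * s"
    and "a \<in> {0<..<1}" and "b \<in> {0<..<1}"
    and "\<And>n. n \<ge> 1 \<Longrightarrow> \<alpha> n \<in> {0..1} \<and> a < \<alpha> n \<and> \<alpha> n \<le> b"
    and "\<And>n. n \<ge> 1 \<Longrightarrow> k n > 0"
    and "x 1 \<in> C"
    and "\<And>n. n \<ge> 1 \<Longrightarrow>
           z n = arg_min_on (\<lambda>u. f u + ereal (1 / (2 * k n) * (dist u (x n))\<^sup>2)) C"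
    and "\<And>n. n \<ge> 1 \<Longrightarrow> y m n = z n"
    and "\<And>n i. n \<ge> 1 \<Longrightarrow> i \<in> {1..<m} \<Longrightarrow>
           y i n = geodesic_comb (\<alpha> n) (y (i + 1) n) ((T (i + 1) ^^ n) (y (i + 1) n))"
    and "\<And>n. n \<ge> 1 \<Longrightarrow> x (n + 1) = geodesic_comb (\<alpha> n) (y 1 n) ((T 1 ^^ n) (y 1 n))"
    and "F = (\<Inter>i\<in>{1..m}. fixed_points C (T i)) \<inter> argmin_set f C"
    and "F \<noteq> {}"
  shows "(\<exists>p\<in>F. x \<longlonglongrightarrow> p) \<longleftrightarrow> liminf (\<lambda>n. ereal (infdist (x n) F)) = 0"
proof -
  note H = assms(1) and C = assms(3,4) and proper = assms(5) and conv = assms(6)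
    and lsc = assms(7) and fin = assms(8) and m = assms(9) and uc = assms(10)
    and T = assms(11) and \<alpha> = assms(16) and k = assms(17) and x1 = assms(18)
    and z = assms(19) and ym = assms(20) and yi = assms(21) and xn = assms(22)
    and F = assms(23) and Fne = assms(24)
  have cat: "CAT0_space TYPE('a)" and compl: "complete (UNIV :: 'a set)"
    using H unfolding Hadamard_space_def by auto
  have F_fix: "p \<in> fixed_points C (T i)" if "p \<in> F" "i \<in> {1..m}" for p i
    using that F by blast
  \<comment> \<open>Some point of \<open>C\<close> has a finite value, so the minimum of
    \<open>f\<close> on \<open>C\<close> is not infinite.\<close>
  have F_fin: "p \<in> argmin_set f C" "p \<in> C" "f p \<noteq> \<infinity>" if "p \<in> F" for p
    using that F fin by (auto simp: argmin_set_def is_arg_min_linorder)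
  have f_ninf: "f u \<noteq> -\<infinity>" for u using proper unfolding proper_fun_def by blast
  have closedF: "closed F"
    unfolding F
    by (intro closed_Int closed_INT ballI closed_fixed_points C closed_argmin_set lsc
        uniformly_continuous_imp_continuous uc)
  obtain p0 where p0: "p0 \<in> F" using Fne by blast
  obtain s0 where s0: "f p0 = ereal s0"
    using F_fin(3)[OF p0] f_ninf[of p0] by (cases "f p0") auto
  \<comment> \<open>The minimum value is the lower bound needed for the existence of proximal
    minimizers.\<close>
  have bound: "ereal s0 \<le> f u" if "u \<in> C" for u
    using F_fin(1)[OF p0] that s0 by (auto simp: argmin_set_def is_arg_min_linorder)
  \<comment> \<open>\<open>arg_min_on\<close> is a choice operator; the existence of a minimizer
    makes \<open>z n\<close> one.\<close>
  have z_min: "is_arg_min (\<lambda>u. f u + ereal (1 / (2 * k n) * (dist u (x n))\<^sup>2)) (\<lambda>u. u \<in> C) (z n)"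
    if "n \<ge> 1" for n
    unfolding z[OF that] arg_min_on_def arg_min_def
    by (rule someI_ex, rule proximal_minimizer_exists[OF H C conv lsc bound F_fin(2,3)[OF p0]])
      (use k[OF that] in auto)
  have zC: "z n \<in> C" if "n \<ge> 1" for n
    using z_min[OF that] by (simp add: is_arg_min_def)
  have z_dist: "dist (z n) p \<le> dist (x n) p" if "n \<ge> 1" "p \<in> F" for n p
    by (rule proximal_minimizer_dist_le[OF cat C(2) conv f_ninf F_fin(1,3)[OF that(2)] _
          z_min[OF that(1)]]) (use k[OF that(1)] in auto)
  have TC: "(T i ^^ n) u \<in> C" if "i \<in> {1..m}" "u \<in> C" for i n u
    using that T[OF that(1)] unfolding total_asymp_quasi_nonexpansive_def
    by (induction n) auto
  define B where "B i c e \<longleftrightarrow> (\<forall>n. 0 \<le> c n \<and> 0 \<le> e n) \<and> summable c \<and> summable e \<and>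
      (\<forall>u\<in>C. \<forall>p\<in>fixed_points C (T i). \<forall>n.
         dist ((T i ^^ Suc n) u) p \<le> (1 + c n) * dist u p + e n)" for i and c e :: "nat \<Rightarrow> real"
  have "\<exists>c e. B i c e" if "i \<in> {1..m}" for i
    unfolding B_def
    using total_asymp_quasi_nonexpansive_affine_bound[OF T[OF that] _ _ C2[OF that]] C1[OF that]
    by blast
  then obtain c e where "\<And>i. i \<in> {1..m} \<Longrightarrow> B i (c i) (e i)" by metis
  then have ce: "\<And>i n. i \<in> {1..m} \<Longrightarrow> 0 \<le> c i n" "\<And>i n. i \<in> {1..m} \<Longrightarrow> 0 \<le> e i n"
      "\<And>i. i \<in> {1..m} \<Longrightarrow> summable (c i)" "\<And>i. i \<in> {1..m} \<Longrightarrow> summable (e i)"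
    and T_dist: "\<And>i u p n. i \<in> {1..m} \<Longrightarrow> u \<in> C \<Longrightarrow> p \<in> fixed_points C (T i) \<Longrightarrow>
        dist ((T i ^^ Suc n) u) p \<le> (1 + c i n) * dist u p + e i n"
    unfolding B_def by blast+
  \<comment> \<open>As \<open>?R\<close> is at least \<open>dist u p\<close>, both endpoints lie in
    the ball of radius \<open>?R\<close> around \<open>p\<close>; balls are convex, so the bound is
    free of \<open>\<alpha>\<close>.\<close>
  have mann: "geodesic_comb (\<alpha> (Suc n)) u ((T i ^^ Suc n) u) \<in> C"
    "p \<in> F \<Longrightarrow> dist (geodesic_comb (\<alpha> (Suc n)) u ((T i ^^ Suc n) u)) p \<le> (1 + c i n) * dist u p + e i n"
    if i: "i \<in> {1..m}" and u: "u \<in> C" for i u n p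
  proof -
    let ?\<alpha> = "\<alpha> (Suc n)" and ?v = "(T i ^^ Suc n) u"
    have a: "?\<alpha> \<in> {0..1}" using \<alpha>[of "Suc n"] by simp
    show "geodesic_comb ?\<alpha> u ?v \<in> C"
      by (rule geodesic_comb_in_convex[OF cat a C(2) u TC[OF i u]])
    assume "p \<in> F"
    let ?R = "(1 + c i n) * dist u p + e i n"
    have "dist u p \<le> ?R"
      using ce(1,2)[OF i, of n] by (simp add: algebra_simps)
    moreover have "dist ?v p \<le> ?R" by (rule T_dist[OF i u F_fix[OF \<open>p \<in> F\<close> i]])
    ultimately have "(1 - ?\<alpha>) * dist u p + ?\<alpha> * dist ?v p \<le> (1 - ?\<alpha>) * ?R + ?\<alpha> * ?R"
      using a by (intro add_mono mult_left_mono) auto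
    also have "\<dots> = ?R" by (simp add: algebra_simps)
    finally show "dist (geodesic_comb ?\<alpha> u ?v) p \<le> ?R"
      using dist_geodesic_comb_le[OF cat a, of u ?v p] by linarith
  qed
  \<comment> \<open>Downward induction from \<open>y m = z\<close>, where the sums are empty and
    \<open>z_dist\<close> applies. \<open>{i<..m}\<close> lists the mappings already used in forming
    \<open>y i\<close>; the step down to \<open>i\<close> brings in
    \<open>T (Suc i)\<close>.\<close>
  have y_bound: "y i (Suc n) \<in> C \<and> (\<forall>p\<in>F. dist (y i (Suc n)) p \<le>
      exp (\<Sum>j\<in>{i<..m}. c j n) * (dist (x (Suc n)) p + (\<Sum>j\<in>{i<..m}. e j n)))"
    if "1 \<le> i" "i \<le> m" for i n
    using that(2,1)
  proof (induction i rule: inc_induct)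
    case base
    then show ?case using ym[of "Suc n"] zC[of "Suc n"] z_dist[of "Suc n"] by simp
  next
    case (step i)
    have i: "Suc i \<in> {1..m}" and im: "i \<in> {1..<m}" using step.hyps step.prems by auto
    have yC: "y (Suc i) (Suc n) \<in> C" using step.IH by simp
    have eq: "y i (Suc n) = geodesic_comb (\<alpha> (Suc n)) (y (Suc i) (Suc n))
        ((T (Suc i) ^^ Suc n) (y (Suc i) (Suc n)))"
      using yi[OF _ im, of "Suc n"] by simp
    have ins: "{i<..m} = insert (Suc i) {Suc i<..m}" using step.hyps by auto
    have "dist (y i (Suc n)) p \<le>
        exp (\<Sum>j\<in>{i<..m}. c j n) * (dist (x (Suc n)) p + (\<Sum>j\<in>{i<..m}. e j n))" if p: "p \<in> F" for p
    proof -
      have "dist (y i (Suc n)) p \<le> exp (c (Suc i) n + (\<Sum>j\<in>{Suc i<..m}. c j n)) *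
          (dist (x (Suc n)) p + (e (Suc i) n + (\<Sum>j\<in>{Suc i<..m}. e j n)))"
        unfolding eq
        by (rule exp_affine_step[OF ce(1)[OF i] _ ce(2)[OF i] _ zero_le_dist mann(2)[OF i yC p]])
          (use step.IH p in \<open>auto intro!: sum_nonneg ce\<close>)
      then show ?thesis unfolding ins by simp
    qed
    then show ?case using mann(1)[OF i yC] unfolding eq by blast
  qed
  \<comment> \<open>With \<open>T 1\<close>, applied last, included, these collect the coefficients
    of one full pass from \<open>x (Suc n)\<close> to \<open>x (Suc (Suc n))\<close>.\<close>
  define c' e' where "c' n = (\<Sum>j\<in>{1..m}. c j n)" and "e' n = (\<Sum>j\<in>{1..m}. e j n)" for n
  have x_step: "dist (x (Suc (Suc n))) p \<le> exp (c' n) * (dist (x (Suc n)) p + e' n)"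
    if p: "p \<in> F" for n p
  proof -
    have 1: "1 \<in> {1..m}" and ins: "{1..m} = insert 1 {1<..m}" using m by auto
    have y1: "y 1 (Suc n) \<in> C" "dist (y 1 (Suc n)) p \<le>
        exp (\<Sum>j\<in>{1<..m}. c j n) * (dist (x (Suc n)) p + (\<Sum>j\<in>{1<..m}. e j n))"
      using y_bound[OF order_refl m] p by auto
    have eq: "x (Suc (Suc n)) = geodesic_comb (\<alpha> (Suc n)) (y 1 (Suc n))
        ((T 1 ^^ Suc n) (y 1 (Suc n)))"
      using xn[of "Suc n"] by simp
    have "dist (x (Suc (Suc n))) p \<le> exp (c 1 n + (\<Sum>j\<in>{1<..m}. c j n)) *
        (dist (x (Suc n)) p + (e 1 n + (\<Sum>j\<in>{1<..m}. e j n)))"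
      unfolding eq
      by (rule exp_affine_step[OF ce(1)[OF 1] _ ce(2)[OF 1] y1(2) zero_le_dist mann(2)[OF 1 y1(1) p]])
        (auto intro!: sum_nonneg ce)
    then show ?thesis unfolding c'_def e'_def ins by simp
  qed
  show ?thesis
  proof
    assume "\<exists>p\<in>F. x \<longlonglongrightarrow> p"
    then obtain p where p: "p \<in> F" "x \<longlonglongrightarrow> p" by blast
    have "(\<lambda>n. infdist (x n) F) \<longlonglongrightarrow> 0"
      using tendsto_infdist[OF p(2), of F] p(1) by simp
    then have "(\<lambda>n. ereal (infdist (x n) F)) \<longlonglongrightarrow> 0" by (simp add: zero_ereal_def)
    then show "liminf (\<lambda>n. ereal (infdist (x n) F)) = 0"
      by (intro lim_imp_Liminf) simp_all
  next
    assume lim: "liminf (\<lambda>n. ereal (infdist (x n) F)) = 0"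
    \<comment> \<open>The iteration is specified from index 1 on and \<open>x 0\<close> is
      arbitrary, so the estimate is applied to the shifted sequence.\<close>
    have "\<exists>p\<in>F. (\<lambda>n. x (Suc n)) \<longlonglongrightarrow> p"
    proof (rule quasi_Fejer_convergent[where c = c' and e = e', OF compl closedF Fne])
      show "dist (x (Suc (Suc n))) p \<le> exp (c' n) * (dist (x (Suc n)) p + e' n)" if "p \<in> F" for n p
        by (rule x_step[OF that])
      show "0 \<le> c' n" "0 \<le> e' n" for n
        unfolding c'_def e'_def by (auto intro!: sum_nonneg ce)
      show "summable c'" "summable e'"
        unfolding c'_def e'_def by (auto intro!: summable_sum ce)
      show "\<exists>n\<ge>N. infdist (x (Suc n)) F < \<epsilon>" if \<epsilon>: "0 < \<epsilon>" for \<epsilon> N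
      proof -
        obtain n where "n \<ge> Suc N" "infdist (x n) F < \<epsilon>"
          using liminf_zero_frequently_less[OF lim \<epsilon>] by blast
        then show ?thesis by (cases n) auto
      qed
    qed
    then show "\<exists>p\<in>F. x \<longlonglongrightarrow> p" by (auto dest: LIMSEQ_imp_Suc)
  qed
qed

end
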